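(* Let $S = \{d \in \mathbb{N} : d \leq 25\} \setminus \{0, 8, 18, 20, 23, 25\}$. There are only finitely many prime numbers of the form $$\sum_{k=0}^{n} (kd+1)!$$ with $(d,n) \in S \times \mathbb{N}$.
   Context: $\mathbb{N}$ denotes the set of non-negative integers. *)

theory Defs
  imports Complex_Main "HOL-Computational_Algebra.Primes"
begin

end

theory Submission
  imports Defs "HOL-Number_Theory.Cong"
begin

text \<open>
  Let $s_n = \sum_{k=0}^n (k d + 1)!$. If $p > 1$ divides $s_n$ for some $n$ with $p \le (n + 1) d + 1$,
  then $p$ divides all later summands as well, so that among $s_n, s_{n+1}, \dots$ only $p$ itself can
  be prime. Such a $p$ exists for each $d$ in question; the smallest ones are at most $32261$, except
  for $p = 3977273$ in the case $d = 19$.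

  For $d = 19$ this is a sum of $209331$ factorials modulo $p$. The quotient of consecutive
  summands is a polynomial $r(k)$ of degree $d$, so its values modulo $p$ come from a table of forward
  differences at the price of $d$ modular additions each, and every summand costs just one modular
  multiplication. Modular multiplication is Montgomery's, on hexadecimal digits.
\<close>

subsection \<open>Polynomials given by their forward differences\<close>

text \<open>
  A list $[c_0, \dots, c_m]$ stands for the polynomial $\sum_j c_j \binom{i}{j}$ in $i$, that is,
  $c_j$ is the $j$-th forward difference at $0$.
\<close>

fun newton :: "nat list \<Rightarrow> nat \<Rightarrow> nat" where
  "newton [] i = 0"
| "newton (c # cs) 0 = c"
| "newton (c # cs) (Suc i) = newton (c # cs) i + newton cs i"

fun shift :: "nat list \<Rightarrow> nat list" where
  "shift (x # y # zs) = (x + y) # shift (y # zs)"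
| "shift xs = xs"

lemma newton_singleton [simp]: "newton [c] i = c"
  by (induction i) simp_all

lemma newton_shift: "newton (shift cs) i = newton cs (Suc i)"
proof (induction cs arbitrary: i rule: shift.induct)
  case (1 x y zs)
  show ?case by (induction i) (simp_all add: 1)
qed simp_all

lemma newton_shift_funpow: "newton ((shift ^^ n) cs) i = newton cs (n + i)"
  by (induction n arbitrary: i) (simp_all add: newton_shift)

lemma shift_neq_Nil: "cs \<noteq> [] \<Longrightarrow> (shift ^^ n) cs \<noteq> []"
  by (induction n) (auto elim: shift.elims)

lemma newton_0: "cs \<noteq> [] \<Longrightarrow> newton cs 0 = hd cs"
  by (cases cs) simp_all

text \<open>
  Multiplication by the linear function $l(i) = a i + b$, by the Leibniz rule
  $\Delta^m (l f)(i) = l(i + m) \Delta^m f(i) + a m \Delta^{m-1} f(i)$. The recursion goes over $m$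
  with $t = a m$, and $c$ is the difference of order $m - 1$.
\<close>

primrec linear_mult :: "nat \<Rightarrow> nat \<Rightarrow> nat \<Rightarrow> nat \<Rightarrow> nat list \<Rightarrow> nat list" where
  "linear_mult a b t c [] = [t * c]"
| "linear_mult a b t c (x # cs) = ((t + b) * x + t * c) # linear_mult a b (t + a) x cs"

lemma newton_linear_mult:
  "newton (linear_mult a b (a * m) c cs) i =
    (a * (m + i) + b) * newton cs i + a * m * newton (c # cs) i"
proof (induction cs arbitrary: m c i)
  case (Cons x cs)
  have "newton (linear_mult a b (a + a * m) x cs) i =
      (a * (Suc m + i) + b) * newton cs i + a * Suc m * newton (x # cs) i" for i
    using Cons.IH[of "Suc m" x i] by simp
  then show ?case
    by (induction i) (simp_all add: algebra_simps)
qed simp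

primrec linear_prod :: "nat \<Rightarrow> nat list \<Rightarrow> nat list" where
  "linear_prod a [] = [1]"
| "linear_prod a (b # bs) = linear_mult a b 0 0 (linear_prod a bs)"

lemma linear_prod_neq_Nil: "linear_prod a bs \<noteq> []"
proof (cases bs)
  case (Cons b bs')
  then show ?thesis by (cases "linear_prod a bs'") simp_all
qed simp

lemma newton_linear_prod: "newton (linear_prod a bs) i = (\<Prod>b\<leftarrow>bs. a * i + b)"
proof (induction bs)
  case (Cons b bs)
  then show ?case using newton_linear_mult[of a b 0 0] by simp
qed simp

text \<open>Raising \<open>j\<close> by one multiplies both sides by \<open>k * d + j + 2\<close>;
  reversing the list puts this factor at its head. For \<open>j = d\<close> the polynomial is the
  quotient of consecutive summands.\<close>

lemma fact_newton_linear_prod: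
  "fact (k * d + 1 + j) = newton (linear_prod d (rev [2..<j + 2])) k * (fact (k * d + 1) :: nat)"
  by (induction j) (simp_all add: newton_linear_prod algebra_simps del: linear_prod.simps)

subsection \<open>Rewriting with hexadecimal numbers\<close>

text \<open>
  The least significant digit is outermost, and every digit is a single unary constructor. So one
  rewrite step per digit suffices once the digit tables below are available as rewrite rules.
\<close>

datatype (plugins only:) hex =
  E | X0 hex | X1 hex | X2 hex | X3 hex | X4 hex | X5 hex | X6 hex | X7 hex
  | X8 hex | X9 hex | XA hex | XB hex | XC hex | XD hex | XE hex | XF hex

definition dgt :: "nat \<Rightarrow> hex \<Rightarrow> hex" where
  "dgt n = [X0, X1, X2, X3, X4, X5, X6, X7, X8, X9, XA, XB, XC, XD, XE, XF] ! n"

text \<open>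
  The equations for \<open>Suc\<close> are needed because the simplifier evaluates sums of ones to such terms.
\<close>

lemma dgt_simps [simp]:
  "dgt 0 = X0" "dgt 1 = X1" "dgt (Suc 0) = X1" "dgt 2 = X2" "dgt (Suc (Suc 0)) = X2"
  "dgt 3 = X3" "dgt (Suc (Suc (Suc 0))) = X3" "dgt 4 = X4" "dgt (Suc (Suc (Suc (Suc 0)))) = X4"
  "dgt 5 = X5" "dgt 6 = X6" "dgt 7 = X7" "dgt 8 = X8" "dgt 9 = X9"
  "dgt 10 = XA" "dgt 11 = XB" "dgt 12 = XC" "dgt 13 = XD" "dgt 14 = XE" "dgt 15 = XF"
  by (simp_all add: dgt_def)

primrec nv :: "hex \<Rightarrow> nat" where
  "nv E = 0"
| "nv (X0 x) = 16 * nv x" | "nv (X1 x) = 1 + 16 * nv x"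
| "nv (X2 x) = 2 + 16 * nv x" | "nv (X3 x) = 3 + 16 * nv x"
| "nv (X4 x) = 4 + 16 * nv x" | "nv (X5 x) = 5 + 16 * nv x"
| "nv (X6 x) = 6 + 16 * nv x" | "nv (X7 x) = 7 + 16 * nv x"
| "nv (X8 x) = 8 + 16 * nv x" | "nv (X9 x) = 9 + 16 * nv x"
| "nv (XA x) = 10 + 16 * nv x" | "nv (XB x) = 11 + 16 * nv x"
| "nv (XC x) = 12 + 16 * nv x" | "nv (XD x) = 13 + 16 * nv x"
| "nv (XE x) = 14 + 16 * nv x" | "nv (XF x) = 15 + 16 * nv x"

primrec len :: "hex \<Rightarrow> nat" where
  "len E = 0"
| "len (X0 x) = Suc (len x)" | "len (X1 x) = Suc (len x)" | "len (X2 x) = Suc (len x)"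
| "len (X3 x) = Suc (len x)" | "len (X4 x) = Suc (len x)" | "len (X5 x) = Suc (len x)"
| "len (X6 x) = Suc (len x)" | "len (X7 x) = Suc (len x)" | "len (X8 x) = Suc (len x)"
| "len (X9 x) = Suc (len x)" | "len (XA x) = Suc (len x)" | "len (XB x) = Suc (len x)"
| "len (XC x) = Suc (len x)" | "len (XD x) = Suc (len x)" | "len (XE x) = Suc (len x)"
| "len (XF x) = Suc (len x)"

text \<open>Fixed width: leading zeros are kept and overflow is cut off. Defining arithmetic through
  \<open>enc\<close> by length and value makes its correctness immediate; the digit rules used for
  evaluation are derived from that.\<close>

primrec enc :: "nat \<Rightarrow> nat \<Rightarrow> hex" where
  "enc 0 v = E"
| "enc (Suc n) v = dgt (v mod 16) (enc n (v div 16))"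

lemma enc_numeral: "enc (numeral k) v = dgt (v mod 16) (enc (pred_numeral k) (v div 16))"
  by (simp only: numeral_eq_Suc[of k] enc.simps)

lemma less_16: "a < 16 \<Longrightarrow> a \<in> {0, 1, 2, 3, 4, 5, 6, 7, 8, 9, 10, 11, 12, 13, 14, 15 :: nat}"
  by (simp add: numeral_eq_Suc less_Suc_eq)

lemma nv_dgt: "a < 16 \<Longrightarrow> nv (dgt a x) = a + 16 * nv x"
  by (drule less_16) auto

lemma len_dgt: "a < 16 \<Longrightarrow> len (dgt a x) = Suc (len x)"
  by (drule less_16) auto

text \<open>Every digit constructor is some \<open>dgt a\<close>, so inductions have two cases
  instead of seventeen.\<close>

lemma hex_dgt_induct [case_names E dgt]:
  assumes "P E" "\<And>a x. a < 16 \<Longrightarrow> P x \<Longrightarrow> P (dgt a x)"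
  shows "P x"
proof (induction x)
  case E
  show ?case by (fact assms(1))
qed (use assms(2)[of 0] assms(2)[of 1] assms(2)[of 2] assms(2)[of 3] assms(2)[of 4] assms(2)[of 5]
  assms(2)[of 6] assms(2)[of 7] assms(2)[of 8] assms(2)[of 9] assms(2)[of 10] assms(2)[of 11]
  assms(2)[of 12] assms(2)[of 13] assms(2)[of 14] assms(2)[of 15] in simp_all)

lemma enc_nv: "enc (len x) (nv x) = x"
  by (induction x rule: hex_dgt_induct) (simp_all add: nv_dgt len_dgt)

lemma len_enc: "len (enc n v) = n"
  by (induction n arbitrary: v) (simp_all add: len_dgt)

lemma nv_enc: "nv (enc n v) = v mod 16 ^ n"
  by (induction n arbitrary: v) (simp_all add: nv_dgt mod_mult2_eq)

text \<open>
  Addition without and with a carry-in. The result has the length of the first argument, and a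
  carry out of it is lost.
\<close>

definition add0 :: "hex \<Rightarrow> hex \<Rightarrow> hex" where
  "add0 x y = enc (len x) (nv x + nv y)"

definition add1 :: "hex \<Rightarrow> hex \<Rightarrow> hex" where
  "add1 x y = enc (len x) (nv x + nv y + 1)"

text \<open>Here \<open>a\<close> may exceed 15; its quotient by 16 is the carry into the next
  digit.\<close>

lemma enc_add_mult: "enc (Suc n) (a + 16 * v) = dgt (a mod 16) (enc n (a div 16 + v))"
proof -
  have "(a + 16 * v) div 16 = a div 16 + v" by simp
  moreover have "(a + 16 * v) mod 16 = a mod 16" by simp
  ultimately show ?thesis by (simp add: add.commute)
qed

lemma add0_dgt:
  assumes "a < 16" "b < 16"
  shows "add0 (dgt a x) (dgt b y) =
    (if a + b < 16 then dgt (a + b) (add0 x y) else dgt (a + b - 16) (add1 x y))"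
proof -
  have "add0 (dgt a x) (dgt b y) = enc (Suc (len x)) ((a + b) + 16 * (nv x + nv y))"
    using assms by (simp add: add0_def nv_dgt len_dgt algebra_simps del: enc.simps)
  also have "\<dots> = dgt ((a + b) mod 16) (enc (len x) ((a + b) div 16 + (nv x + nv y)))"
    by (rule enc_add_mult)
  finally show ?thesis
    using assms by (simp add: add0_def add1_def mod_if div_if)
qed

lemma add1_dgt:
  assumes "a < 16" "b < 16"
  shows "add1 (dgt a x) (dgt b y) =
    (if a + b < 15 then dgt (a + b + 1) (add0 x y) else dgt (a + b - 15) (add1 x y))"
proof -
  have "add1 (dgt a x) (dgt b y) = enc (Suc (len x)) ((a + b + 1) + 16 * (nv x + nv y))"
    using assms by (simp add: add1_def nv_dgt len_dgt algebra_simps del: enc.simps)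
  also have "\<dots> = dgt ((a + b + 1) mod 16) (enc (len x) ((a + b + 1) div 16 + (nv x + nv y)))"
    by (rule enc_add_mult)
  finally show ?thesis
    using assms by (simp add: add0_def add1_def mod_if div_if)
qed

lemma add_E: "add0 x E = x" "add0 E y = E" "add1 E y = E"
  by (simp_all add: add0_def add1_def enc_nv)

text \<open>A seven digit \<open>row\<close> gets added to a six digit accumulator, so a carry may
  run on after the second summand has ended.\<close>

lemma add1_E_right:
  "a < 16 \<Longrightarrow> add1 (dgt a x) E = (if a < 15 then dgt (a + 1) x else X0 (add1 x E))"
  using add1_dgt[of a 0 x E] by (simp add: add0_def add1_def enc_nv)

text \<open>Unfolding with this turns a statement about all digits into one rewrite rule per digit
  or pair of digits.\<close>

lemma ball_16: "(\<forall>a<16::nat. P a) \<longleftrightarrow>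
  P 0 \<and> P 1 \<and> P 2 \<and> P 3 \<and> P 4 \<and> P 5 \<and> P 6 \<and> P 7 \<and>
  P 8 \<and> P 9 \<and> P 10 \<and> P 11 \<and> P 12 \<and> P 13 \<and> P 14 \<and> P 15"
  using less_16 by auto

lemma add0_all: "\<forall>a<16. \<forall>b<16. \<forall>x y. add0 (dgt a x) (dgt b y) =
    (if a + b < 16 then dgt (a + b) (add0 x y) else dgt (a + b - 16) (add1 x y))"
  using add0_dgt by blast

lemma add1_all: "\<forall>a<16. \<forall>b<16. \<forall>x y. add1 (dgt a x) (dgt b y) =
    (if a + b < 15 then dgt (a + b + 1) (add0 x y) else dgt (a + b - 15) (add1 x y))"
  using add1_dgt by blast

lemma add1_E_all:
  "\<forall>a<16. \<forall>x. add1 (dgt a x) E = (if a < 15 then dgt (a + 1) x else X0 (add1 x E))"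
  using add1_E_right by blast

lemmas add_table = add_E
  add0_all[unfolded ball_16, simplified]
  add1_all[unfolded ball_16, simplified]
  add1_E_all[unfolded ball_16, simplified]

text \<open>
  The product of \<open>x\<close> with one digit, plus a carry. The carry and the digit are passed as
  constructors to keep them atomic.
\<close>

definition row :: "(hex \<Rightarrow> hex) \<Rightarrow> (hex \<Rightarrow> hex) \<Rightarrow> hex \<Rightarrow> hex" where
  "row c a x = enc (Suc (len x)) (nv (c E) + nv (a E) * nv x)"

lemma row_dgt:
  assumes "c < 16" "a < 16" "b < 16"
  shows "row (dgt c) (dgt a) (dgt b x) =
    dgt ((a * b + c) mod 16) (row (dgt ((a * b + c) div 16)) (dgt a) x)"
proof -
  \<comment> \<open>Since 15 * 15 + 15 = 240 < 256, the carry is again a single digit.\<close>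
  have "a * b \<le> 15 * 15"
    using assms by (intro mult_le_mono) auto
  then have *: "(a * b + c) div 16 < 16" using assms by simp
  have "row (dgt c) (dgt a) (dgt b x) = enc (Suc (Suc (len x))) ((a * b + c) + 16 * (a * nv x))"
    using assms by (simp add: row_def nv_dgt len_dgt algebra_simps del: enc.simps)
  also have "\<dots> = dgt ((a * b + c) mod 16) (enc (Suc (len x)) ((a * b + c) div 16 + a * nv x))"
    by (rule enc_add_mult)
  finally show ?thesis
    using assms * by (simp add: row_def nv_dgt)
qed

lemma row_E: "c < 16 \<Longrightarrow> row (dgt c) a E = dgt c E"
  by (simp add: row_def nv_dgt)

lemma row_all: "\<forall>a<16. \<forall>b<16. \<forall>x. row (dgt c) (dgt a) (dgt b x) =
    dgt ((a * b + c) mod 16) (row (dgt ((a * b + c) div 16)) (dgt a) x)" if "c < 16"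
  using row_dgt that by blast

lemma row_E_all: "\<forall>c<16. \<forall>a. row (dgt c) a E = dgt c E"
  using row_E by blast

text \<open>
  One conjunction per carry, since the simplifier needs quadratic time to split a conjunction.
\<close>

lemmas row_table = row_E_all[unfolded ball_16, simplified]
  row_all[of 0, unfolded ball_16, simplified]
  row_all[of 1, unfolded ball_16, simplified]
  row_all[of 2, unfolded ball_16, simplified]
  row_all[of 3, unfolded ball_16, simplified]
  row_all[of 4, unfolded ball_16, simplified]
  row_all[of 5, unfolded ball_16, simplified]
  row_all[of 6, unfolded ball_16, simplified]
  row_all[of 7, unfolded ball_16, simplified]
  row_all[of 8, unfolded ball_16, simplified]
  row_all[of 9, unfolded ball_16, simplified]
  row_all[of 10, unfolded ball_16, simplified]
  row_all[of 11, unfolded ball_16, simplified]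
  row_all[of 12, unfolded ball_16, simplified]
  row_all[of 13, unfolded ball_16, simplified]
  row_all[of 14, unfolded ball_16, simplified]
  row_all[of 15, unfolded ball_16, simplified]

definition tail :: "hex \<Rightarrow> hex" where
  "tail x = enc (len x - 1) (nv x div 16)"

lemma tail_dgt: "a < 16 \<Longrightarrow> tail (dgt a x) = x"
  by (simp add: tail_def len_dgt nv_dgt enc_nv)

lemma tail_all: "\<forall>a<16. \<forall>x. tail (dgt a x) = x"
  using tail_dgt by blast

lemmas tail_table = tail_all[unfolded ball_16, simplified]

text \<open>
  With $2^{23}/3 \le M \le 2^{22}$, the top digit of a six digit number below $2 (2^{23} - M)$ tells
  which of $0$, $M$, $2M$ to subtract in order to get below $2^{23} - M$ again.
\<close>

definition sub_sel :: "nat \<Rightarrow> hex \<Rightarrow> hex \<Rightarrow> hex" where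
  "sub_sel M t x = (let h = nv t mod 16 in
    if h < 4 then x else if h < 8 then add0 x (enc 6 (2 ^ 24 - M))
    else add0 x (enc 6 (2 ^ 24 - 2 * M)))"

lemma sub_sel_all: "\<forall>a<16. \<forall>t x. sub_sel M (dgt a t) x =
    (if a < 4 then x else if a < 8 then add0 x (enc 6 (2 ^ 24 - M))
     else add0 x (enc 6 (2 ^ 24 - 2 * M)))"
  by (simp add: sub_sel_def nv_dgt)

lemmas sub_sel_table = sub_sel_all[unfolded ball_16, simplified]

definition red :: "nat \<Rightarrow> hex \<Rightarrow> hex" where
  "red M x = sub_sel M (tail (tail (tail (tail (tail x))))) x"

text \<open>
  One digit of a Montgomery reduction: add the multiple of \<open>M\<close> that clears the lowest digit, then
  drop that digit. For odd \<open>M\<close> we have $M^4 \equiv 1$ modulo $16$, so $15 M^3$ is $-1/M$ modulo $16$.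
\<close>

definition mont :: "nat \<Rightarrow> hex \<Rightarrow> hex" where
  "mont M x = add0 (tail x)
    (enc 6 ((nv x mod 16 + M * ((nv x mod 16 * (15 * M ^ 3)) mod 16)) div 16))"

lemma mont_all: "\<forall>a<16. \<forall>x. mont M (dgt a x) =
    add0 x (enc 6 ((a + M * ((a * (15 * M ^ 3)) mod 16)) div 16))"
  by (simp add: mont_def nv_dgt tail_dgt)

lemmas mont_table = mont_all[unfolded ball_16]

definition double :: "nat \<Rightarrow> hex \<Rightarrow> hex" where
  "double M x = red M (add0 x x)"

text \<open>Interleaved Montgomery multiplication: each digit of \<open>v\<close>, lowest first,
  contributes its multiple of \<open>y\<close>, followed by a division by 16 modulo
  \<open>M\<close>.\<close>

primrec mulN :: "nat \<Rightarrow> nat \<Rightarrow> nat \<Rightarrow> hex \<Rightarrow> hex \<Rightarrow> hex" where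
  "mulN M 0 v y acc = acc"
| "mulN M (Suc n) v y acc = mulN M n (v div 16) y (mont M (add0 (row X0 (dgt (v mod 16)) y) acc))"

definition mul :: "nat \<Rightarrow> hex \<Rightarrow> hex \<Rightarrow> hex \<Rightarrow> hex" where
  "mul M x y acc = mulN M (len x) (nv x) y acc"

lemma mul_E: "mul M E y acc = acc"
  by (simp add: mul_def)

lemma mul_dgt:
  "a < 16 \<Longrightarrow> mul M (dgt a x) y acc = mul M x y (mont M (add0 (row X0 (dgt a) y) acc))"
  by (simp add: mul_def nv_dgt len_dgt)

lemma mul_all: "\<forall>a<16. \<forall>x y acc. mul M (dgt a x) y acc =
    mul M x y (mont M (add0 (row X0 (dgt a) y) acc))"
  using mul_dgt by blast

lemmas mul_table = mul_E mul_all[unfolded ball_16, simplified]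

fun upd :: "nat \<Rightarrow> hex list \<Rightarrow> hex list" where
  "upd M [] = []"
| "upd M [x] = [x]"
| "upd M (x # y # zs) = red M (add0 x y) # upd M (y # zs)"

text \<open>
  The forward differences of $r(k) = \prod_{j=2}^{d+1} (k d + j)$ at the current $k$, each multiplied
  by $16^6$ to compensate for the Montgomery reductions, then $(k d + 1)!$, then the partial sum.
\<close>

datatype state = St "hex list" hex hex

text \<open>\<open>A\<close> occurs twice on the right; as the argument of a separate function it is
  evaluated before it is duplicated. The same holds for \<open>double\<close>.\<close>

definition advance :: "nat \<Rightarrow> hex list \<Rightarrow> hex \<Rightarrow> hex \<Rightarrow> state" where
  "advance M D A S = St (upd M D) A (red M (add0 S A))"

fun step where
  "step M (St (x # D) A S) = advance M (x # D) (red M (mul M x A (X0 (X0 (X0 (X0 (X0 (X0 E)))))))) S"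

text \<open>
  Doubling and adding is much faster here than dividing a large numeral by \<open>M\<close>.
\<close>

primrec residue_num :: "nat \<Rightarrow> num \<Rightarrow> hex" where
  "residue_num M num.One = X1 (X0 (X0 (X0 (X0 (X0 E)))))"
| "residue_num M (num.Bit0 n) = double M (residue_num M n)"
| "residue_num M (num.Bit1 n) =
    red M (add0 (double M (residue_num M n)) (X1 (X0 (X0 (X0 (X0 (X0 E)))))))"

definition residue :: "nat \<Rightarrow> nat \<Rightarrow> hex" where
  "residue M c = (if c = 0 then X0 (X0 (X0 (X0 (X0 (X0 E))))) else residue_num M (num_of_nat c))"

lemma residue_numeral: "residue M (numeral n) = residue_num M n"
  by (simp add: residue_def num_of_nat_numeral_eq)

text \<open>
  The factor $16777216$ is $16^6$.
\<close>

definition init :: "nat \<Rightarrow> nat \<Rightarrow> state" where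
  "init M d = St (map (\<lambda>c. residue M (c * 16777216)) (linear_prod d (rev [2..<d + 2])))
     (X1 (X0 (X0 (X0 (X0 (X0 E)))))) (X1 (X0 (X0 (X0 (X0 (X0 E))))))"

primrec total :: "state \<Rightarrow> hex" where
  "total (St D A S) = S"

definition run :: "nat \<Rightarrow> nat \<Rightarrow> state \<Rightarrow> state" where
  "run M n = step M ^^ n"

text \<open>Splitting the step count along its binary digits avoids decrementing a numeral at each
  step. The rule for \<open>Suc 0\<close> is there because \<open>simp\<close> rewrites 1 to
  it.\<close>

lemma run_simps:
  "run M (Suc 0) s = step M s"
  "run M (numeral num.One) s = step M s"
  "run M (numeral (num.Bit0 n)) s = run M (numeral n) (run M (numeral n) s)"
  "run M (numeral (num.Bit1 n)) s = run M (numeral n) (run M (numeral n) (step M s))"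
proof -
  show "run M (Suc 0) s = step M s" "run M (numeral num.One) s = step M s"
    by (simp_all add: run_def)
  show "run M (numeral (num.Bit0 n)) s = run M (numeral n) (run M (numeral n) s)"
    by (simp only: run_def numeral_Bit0 funpow_add o_apply)
  show "run M (numeral (num.Bit1 n)) s = run M (numeral n) (run M (numeral n) (step M s))"
    by (simp only: run_def numeral_Bit1 funpow_add o_apply funpow.simps One_nat_def id_apply)
qed

lemmas comp_rules = add_table row_table tail_table red_def mul_table upd.simps step.simps
  advance_def run_simps
  linear_prod.simps linear_mult.simps arith_simps mult_zero_right add_0_right mult_1 mult_1_right
  list.map residue_numeral residue_num.simps double_def total.simps

declare linear_prod.simps [simp del] linear_mult.simps [simp del]

subsection \<open>Correctness of the modular arithmetic\<close>

lemma len_add: "len (add0 x y) = len x"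
  by (simp add: add0_def len_enc)

lemma nv_add: "nv (add0 x y) = (nv x + nv y) mod 16 ^ len x"
  by (simp add: add0_def nv_enc)

lemma nv_less: "nv x < 16 ^ len x"
  by (metis enc_nv nv_enc mod_less_divisor zero_less_power zero_less_numeral)

lemma tail_props: "len (tail x) = len x - 1" "nv (tail x) = nv x div 16"
proof -
  show "len (tail x) = len x - 1" by (simp add: tail_def len_enc)
  show "nv (tail x) = nv x div 16"
  proof (induction x rule: hex_dgt_induct)
    case E
    then show ?case by (simp add: tail_def)
  next
    case (dgt a x)
    then show ?case by (simp add: tail_dgt nv_dgt)
  qed
qed

section \<open>Finiteness from a single divisor\<close>

definition primes_sum_fact :: "nat \<Rightarrow> nat set" where
  "primes_sum_fact d = {q. prime q \<and> (\<exists>m. q = (\<Sum>k = 0..m. fact (k * d + 1)))}"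

lemma finite_primes_sum_fact:
  assumes "1 < p" "p dvd (\<Sum>k = 0..n. fact (k * d + 1))" "p \<le> Suc n * d + 1"
  shows "finite (primes_sum_fact d)"
  unfolding primes_sum_fact_def
proof (rule finite_subset)
  let ?s = "\<lambda>m. \<Sum>k = 0..m. fact (k * d + 1) :: nat"
  have dvd: "p dvd ?s m" if "n \<le> m" for m
    using that
  proof (induction m rule: dec_induct)
    case (step m)
    have "Suc n * d \<le> Suc m * d" using step by (intro mult_right_mono) auto
    then have "p \<le> Suc m * d + 1" using assms(3) by linarith
    then have "p dvd fact (Suc m * d + 1)" using assms(1) by (intro dvd_fact) auto
    with step show ?case by simp
  qed (use assms in simp)
  show "{q. prime q \<and> (\<exists>m. q = ?s m)} \<subseteq> insert p (?s ` {..<n})"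
  proof (intro subsetI)
    fix q assume "q \<in> {q. prime q \<and> (\<exists>m. q = ?s m)}"
    then obtain m where m: "prime q" "q = ?s m" by auto
    show "q \<in> insert p (?s ` {..<n})"
    proof (cases "m < n")
      case False
      then have "p dvd q" using dvd m by simp
      then have "p = q" using m(1) assms(1) by (auto simp: prime_nat_iff)
      then show ?thesis by simp
    qed (use m in auto)
  qed
qed simp

text \<open>Oddness makes \<open>M\<close> invertible modulo 16 and 16 invertible modulo
  \<open>M\<close>. The two bounds are what lets the top digit alone decide how much to
  subtract.\<close>

locale modulus =
  fixes M :: nat
  assumes odd: "odd M" and lower: "2 ^ 23 \<le> 3 * M" and upper: "M \<le> 2 ^ 22"
begin

lemma coprime_16: "coprime (16 ^ n) M"
proof -
  have "coprime (2 ^ (4 * n)) M" using odd by simp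
  then show ?thesis by (simp only: power_mult) simp
qed

text \<open>Residues are reduced only below \<open>2 ^ 23 - M\<close>, not below \<open>M\<close>:
  this bound can be restored by looking at one digit, and the sum of two such numbers still fits
  into six digits.\<close>

definition represents :: "hex \<Rightarrow> nat \<Rightarrow> bool" where
  "represents x v \<longleftrightarrow> len x = 6 \<and> nv x < 2 ^ 23 - M \<and> [nv x = v] (mod M)"

lemma red:
  assumes "len x = 6" "nv x < 2 * (2 ^ 23 - M)" "[nv x = v] (mod M)"
  shows "represents (red M x) v"
proof -
  define h where "h = nv x div 2 ^ 20"
  have bound: "nv x < 2 ^ 24" using nv_less[of x] assms(1) by simp
  have top: "nv (tail (tail (tail (tail (tail x))))) mod 16 = h"
    using bound by (simp add: tail_props div_mult2_eq[symmetric] h_def)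
  \<comment> \<open>Six digit addition loses a carry of \<open>2 ^ 24\<close>, so adding
    \<open>2 ^ 24 - q * M\<close> subtracts \<open>q * M\<close>.\<close>
  have sub: "represents (add0 x (enc 6 (2 ^ 24 - q * M))) v"
    if "q * M \<le> nv x" "nv x - q * M < 2 ^ 23 - M" for q
  proof -
    have "q * M < 2 ^ 24" using that(1) bound by linarith
    have "nv (add0 x (enc 6 (2 ^ 24 - q * M))) = (nv x + (2 ^ 24 - q * M)) mod 2 ^ 24"
      using assms(1) by (simp add: nv_add nv_enc mod_add_right_eq)
    also have "nv x + (2 ^ 24 - q * M) = (nv x - q * M) + 2 ^ 24"
      using that(1) \<open>q * M < 2 ^ 24\<close> by linarith
    also have "((nv x - q * M) + 2 ^ 24) mod 2 ^ 24 = nv x - q * M"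
      using bound by (simp only: mod_add_self2) simp
    finally have eq: "nv (add0 x (enc 6 (2 ^ 24 - q * M))) = nv x - q * M" .
    have "[nv x - q * M = v] (mod M)"
      using assms(3) that(1)
      by (metis cong_def le_add_diff_inverse mod_mult_self2 mult.commute add.commute)
    with eq that(2) assms(1) show ?thesis by (simp add: represents_def len_add)
  qed
  have red: "red M x = (if h < 4 then x else if h < 8 then add0 x (enc 6 (2 ^ 24 - 1 * M))
      else add0 x (enc 6 (2 ^ 24 - 2 * M)))"
    by (simp only: red_def sub_sel_def top Let_def mult_1)
  consider "h < 4" | "4 \<le> h" "h < 8" | "8 \<le> h" by linarith
  then show ?thesis
  proof cases
    case 1
    then have "nv x < 2 ^ 22" unfolding h_def by (simp add: div_less_iff_less_mult)
    with 1 red assms upper show ?thesis by (simp add: represents_def)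
  next
    case 2
    then have "2 ^ 22 \<le> nv x" "nv x < 2 ^ 23"
      unfolding h_def by (simp_all add: div_less_iff_less_mult less_eq_div_iff_mult_less_eq)
    then have "represents (add0 x (enc 6 (2 ^ 24 - 1 * M))) v"
      using upper by (intro sub) linarith+
    with 2 red show ?thesis by simp
  next
    case 3
    then have "2 ^ 23 \<le> nv x"
      unfolding h_def by (simp_all add: less_eq_div_iff_mult_less_eq)
    \<comment> \<open>The new bound \<open>2 * (2 ^ 23 - M) - 2 * M \<le> 2 ^ 23 - M\<close> amounts
      to \<open>2 ^ 23 \<le> 3 * M\<close>.\<close>
    then have "represents (add0 x (enc 6 (2 ^ 24 - 2 * M))) v"
      using upper lower assms(2) by (intro sub) linarith+
    with 3 red show ?thesis by simp
  qed
qed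

lemma red_add:
  assumes "represents x v" "represents y w"
  shows "represents (red M (add0 x y)) (v + w)"
proof (rule red)
  have "nv x + M < 2 ^ 23" "nv y + M < 2 ^ 23"
    using assms by (simp_all add: represents_def less_diff_conv)
  then have "nv x + nv y < 2 ^ 24" by simp
  then have "nv (add0 x y) = nv x + nv y"
    using assms by (simp add: nv_add represents_def)
  then show "nv (add0 x y) < 2 * (2 ^ 23 - M)" "[nv (add0 x y) = v + w] (mod M)"
    using assms by (auto simp: represents_def intro: cong_add)
  show "len (add0 x y) = 6" using assms by (simp add: len_add represents_def)
qed

lemma mont:
  assumes "len x = 7"
  shows "len (mont M x) = 6"
    and "nv x + 15 * M < 16 ^ 7 \<Longrightarrow> 16 * nv (mont M x) \<le> nv x + 15 * M"
    and "nv x + 15 * M < 16 ^ 7 \<Longrightarrow> [16 * nv (mont M x) = nv x] (mod M)"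
proof -
  show "len (mont M x) = 6" using assms by (simp add: mont_def len_add tail_props)
  define a where "a = nv x mod 16"
  define q where "q = a * (15 * M ^ 3) mod 16"
  have "a < 16" "q < 16" by (simp_all add: a_def q_def)
  have M4: "M ^ 4 mod 16 = 1"
  proof -
    have "M mod 16 \<in> {1, 3, 5, 7, 9, 11, 13, 15}"
    proof -
      have "odd (M mod 16)" using odd by (simp add: dvd_mod_iff)
      moreover have "M mod 16 < 16" by simp
      ultimately show ?thesis using less_16[of "M mod 16"] by auto
    qed
    then have "(M mod 16) ^ 4 mod 16 = 1" by auto
    then show ?thesis by (simp add: power_mod)
  qed
  \<comment> \<open>Modulo 16 the sum is \<open>a + 15 * a * M ^ 4\<close>, hence
    \<open>16 * a\<close>.\<close>
  have "16 dvd a + M * q"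
  proof -
    have "(a + M * q) mod 16 = (a + M * (a * (15 * M ^ 3))) mod 16"
      unfolding q_def by (metis mod_add_right_eq mod_mult_right_eq)
    also have "a + M * (a * (15 * M ^ 3)) = a + 15 * a * M ^ 4"
      by (simp add: power4_eq_xxxx power3_eq_cube)
    also have "\<dots> mod 16 = (a + 15 * a * (M ^ 4 mod 16)) mod 16"
      by (metis mod_add_right_eq mod_mult_right_eq)
    finally show ?thesis using M4 by (simp add: mod_eq_0_iff_dvd)
  qed
  then obtain c where c: "a + M * q = 16 * c" by blast
  have "M * q \<le> M * 15" using \<open>q < 16\<close> by (intro mult_le_mono) auto
  then have "16 * c < 16 + 15 * 2 ^ 22" using c \<open>a < 16\<close> upper by linarith
  then have "c < 2 ^ 24" by simp
  have "nv (mont M x) = (nv x div 16 + c) mod 2 ^ 24"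
    using assms c \<open>c < 2 ^ 24\<close>
    by (simp add: mont_def nv_add tail_props nv_enc flip: a_def q_def)
  moreover have sum: "16 * (nv x div 16 + c) = nv x + M * q"
  proof -
    have "16 * (nv x div 16 + c) = (16 * (nv x div 16) + a) + M * q"
      using c by (simp add: distrib_left)
    then show ?thesis by (simp add: a_def)
  qed
  moreover assume "nv x + 15 * M < 16 ^ 7"
  then have "nv x + M * q < 16 ^ 7" using \<open>M * q \<le> M * 15\<close> by linarith
  then have "nv x div 16 + c < 2 ^ 24" using sum by simp
  ultimately have eq: "16 * nv (mont M x) = nv x + M * q" by simp
  show "16 * nv (mont M x) \<le> nv x + 15 * M"
    using eq \<open>M * q \<le> M * 15\<close> by simp
  show "[16 * nv (mont M x) = nv x] (mod M)"
    unfolding eq by (simp add: cong_def)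
qed

text \<open>The bound on the accumulator reproduces itself: one round yields at most
  \<open>(15 * nv y + (nv y + M) + 15 * M) / 16 = nv y + M\<close>. Before the division everything
  is below \<open>16 * 2 ^ 23\<close>, so seven digits suffice.\<close>

lemma mulN:
  assumes "len y = 6" "nv y < 2 ^ 23 - M" "len z = 6" "nv z \<le> nv y + M"
  shows "len (mulN M n v y z) = 6 \<and> nv (mulN M n v y z) \<le> nv y + M \<and>
    [16 ^ n * nv (mulN M n v y z) = nv z + (v mod 16 ^ n) * nv y] (mod M)"
  using assms(3,4)
proof (induction n arbitrary: v z)
  case (Suc n)
  define a where "a = v mod 16"
  define x where "x = add0 (row X0 (dgt a) y) z"
  have "a < 16" by (simp add: a_def)
  have "a * nv y \<le> 15 * nv y" using \<open>a < 16\<close> by (intro mult_right_mono) auto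
  have "nv y + M < 2 ^ 23" using assms(2) by linarith
  have "a * nv y < 15 * 2 ^ 23" using \<open>a * nv y \<le> 15 * nv y\<close> \<open>nv y + M < 2 ^ 23\<close> by linarith
  then have "a * nv y < 16 ^ 7" by (rule less_trans) simp
  then have row: "len (row X0 (dgt a) y) = 7" "nv (row X0 (dgt a) y) = a * nv y"
    using \<open>a < 16\<close> assms(1)
    by (simp_all add: row_def len_enc nv_enc nv_dgt del: enc.simps)
  have "a * nv y + nv z < 16 * 2 ^ 23"
    using \<open>a * nv y < 15 * 2 ^ 23\<close> Suc.prems(2) \<open>nv y + M < 2 ^ 23\<close> by linarith
  then have x: "len x = 7" "nv x = a * nv y + nv z"
    using row by (simp_all add: x_def len_add nv_add)
  have "nv x + 15 * M < 16 * 2 ^ 23"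
    using Suc.prems(2) \<open>a * nv y \<le> 15 * nv y\<close> \<open>nv y + M < 2 ^ 23\<close> unfolding x(2) by linarith
  then have "nv x + 15 * M < 16 ^ 7" by (rule less_trans) simp
  note mont = mont(1)[OF x(1)] mont(2,3)[OF x(1) this]
  define w where "w = mulN M n (v div 16) y (mont M x)"
  have "nv (mont M x) \<le> nv y + M"
    using mont(2) x Suc.prems \<open>a * nv y \<le> 15 * nv y\<close> by linarith
  from Suc.IH[OF mont(1) this, of "v div 16"]
  have w: "len w = 6" "nv w \<le> nv y + M"
    "[16 ^ n * nv w = nv (mont M x) + (v div 16 mod 16 ^ n) * nv y] (mod M)"
    by (simp_all add: w_def)
  have "[16 * (16 ^ n * nv w) = 16 * (nv (mont M x) + (v div 16 mod 16 ^ n) * nv y)] (mod M)"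
    by (intro cong_mult w cong_refl)
  also have "[16 * (nv (mont M x) + (v div 16 mod 16 ^ n) * nv y) =
      nv x + 16 * (v div 16 mod 16 ^ n) * nv y] (mod M)"
    unfolding distrib_left using mont(3) by (intro cong_add) (auto simp: mult.assoc)
  also have "nv x + 16 * (v div 16 mod 16 ^ n) * nv y = nv z + (v mod 16 ^ Suc n) * nv y"
    by (simp add: x mod_mult2_eq a_def algebra_simps)
  finally have "[16 ^ Suc n * nv w = nv z + (v mod 16 ^ Suc n) * nv y] (mod M)"
    by (simp add: mult.assoc)
  then show ?case using w by (simp add: w_def a_def x_def)
qed simp

text \<open>Six rounds divide by \<open>16 ^ 6\<close>, which cancels the factor carried by
  \<open>x\<close>.\<close>

lemma red_mul:
  assumes "represents x (v * 16 ^ 6)" "represents y w"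
  shows "represents (red M (mul M x y (X0 (X0 (X0 (X0 (X0 (X0 E)))))))) (v * w)"
proof (rule red)
  define z where "z = mul M x y (X0 (X0 (X0 (X0 (X0 (X0 E))))))"
  have z: "len z = 6" "nv z \<le> nv y + M" "[16 ^ 6 * nv z = nv x * nv y] (mod M)"
    using mulN[of y "X0 (X0 (X0 (X0 (X0 (X0 E)))))" "len x" "nv x"] assms nv_less[of x]
    by (simp_all add: z_def mul_def represents_def)
  have "[16 ^ 6 * nv z = v * 16 ^ 6 * w] (mod M)"
    using z(3) assms unfolding represents_def by (blast intro: cong_trans cong_mult)
  then have "[16 ^ 6 * nv z = 16 ^ 6 * (v * w)] (mod M)" by (simp add: mult_ac)
  then show "[nv z = v * w] (mod M)"
    using coprime_16 cong_mult_lcancel_nat by blast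
  show "len z = 6" by fact
  \<comment> \<open>\<open>nv z \<le> nv y + M < 2 ^ 23 \<le> 2 * (2 ^ 23 - M)\<close>, the last
    because \<open>M \<le> 2 ^ 22\<close>.\<close>
  show "nv z < 2 * (2 ^ 23 - M)"
    using z(2) assms(2) upper by (simp add: represents_def diff_mult_distrib2 less_diff_conv)
qed

section \<open>The loop invariant\<close>

fun represents_state :: "state \<Rightarrow> nat list \<Rightarrow> nat \<Rightarrow> nat \<Rightarrow> bool" where
  "represents_state (St D A S) cs a s \<longleftrightarrow>
    list_all2 (\<lambda>x c. represents x (c * 16 ^ 6)) D cs \<and> represents A a \<and> represents S s"

lemma upd:
  "list_all2 (\<lambda>x c. represents x (c * 16 ^ 6)) D cs \<Longrightarrow>
   list_all2 (\<lambda>x c. represents x (c * 16 ^ 6)) (upd M D) (shift cs)"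
proof (induction cs arbitrary: D rule: shift.induct)
  case (1 c c' cs)
  then obtain x y zs where D: "D = x # y # zs" by (auto simp: list_all2_Cons2)
  from 1 have "list_all2 (\<lambda>x c. represents x (c * 16 ^ 6)) (upd M (y # zs)) (shift (c' # cs))"
    by (simp add: D)
  moreover have "represents (red M (add0 x y)) (c * 16 ^ 6 + c' * 16 ^ 6)"
    using 1 by (intro red_add) (simp_all add: D)
  ultimately show ?case by (simp add: D distrib_right)
qed (auto simp: list_all2_Cons2)

lemma step:
  assumes "represents_state st cs a s" "cs \<noteq> []"
  shows "represents_state (step M st) (shift cs) (a * hd cs) (s + a * hd cs)"
proof -
  from assms obtain x D A S c cs' where *: "st = St (x # D) A S" "cs = c # cs'"
    by (cases st; cases cs) (auto simp: list_all2_Cons2)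
  have "represents (red M (mul M x A (X0 (X0 (X0 (X0 (X0 (X0 E)))))))) (a * c)"
    using assms red_mul[of x c A a] by (simp add: * mult.commute)
  then show ?thesis
    using assms upd[of "x # D" cs] by (auto simp: * advance_def intro!: red_add)
qed

lemma represents_1: "represents (X1 (X0 (X0 (X0 (X0 (X0 E)))))) 1"
  using upper by (simp add: represents_def)

lemma represents_double: "represents x v \<Longrightarrow> represents (double M x) (2 * v)"
  using red_add[of x v x v] by (simp add: double_def mult_2)

lemma represents_residue_num: "represents (residue_num M n) (numeral n)"
proof (induction n)
  case (Bit0 n)
  then show ?case using represents_double by (fastforce simp: numeral_Bit0)
next
  case (Bit1 n)
  then show ?case using red_add[OF represents_double represents_1] by (fastforce simp: numeral_Bit1)
qed (use represents_1 in simp)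

lemma represents_residue: "represents (residue M c) c"
proof (cases "c = 0")
  case True
  then show ?thesis using upper by (simp add: residue_def represents_def)
next
  case False
  then show ?thesis using represents_residue_num[of "num_of_nat c"]
    by (simp add: residue_def numeral_num_of_nat)
qed

lemma represents_state_init: "represents_state (init M d) (linear_prod d (rev [2..<d + 2])) 1 1"
proof -
  have "list_all2 (\<lambda>x c. represents x (c * 16 ^ 6))
      (map (\<lambda>c. residue M (c * 16777216)) cs) cs" for cs
    using represents_residue by (simp add: list_all2_map1 list_all2_same)
  then show ?thesis using represents_1 by (simp add: init_def)
qed

text \<open>After \<open>n\<close> shifts the head of the difference list is the value of the
  polynomial at \<open>n\<close>, which is the factor from \<open>fact (n * d + 1)\<close> to the
  next summand.\<close>

lemma represents_state_run:
  "represents_state (run M n (init M d)) ((shift ^^ n) (linear_prod d (rev [2..<d + 2])))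
     (fact (n * d + 1)) (\<Sum>k = 0..n. fact (k * d + 1))"
proof (induction n)
  case 0
  show ?case using represents_state_init by (simp add: run_def)
next
  case (Suc n)
  have "hd ((shift ^^ n) (linear_prod d (rev [2..<d + 2]))) =
      newton (linear_prod d (rev [2..<d + 2])) n"
    using newton_0[OF shift_neq_Nil[OF linear_prod_neq_Nil]] by (simp add: newton_shift_funpow)
  then have "fact (n * d + 1) * hd ((shift ^^ n) (linear_prod d (rev [2..<d + 2]))) =
      fact (Suc n * d + 1)"
    using fact_newton_linear_prod[of n d d] by (simp add: algebra_simps)
  then show ?case
    using step[OF Suc shift_neq_Nil[OF linear_prod_neq_Nil]] by (simp add: run_def)
qed

lemma dvd_sum_fact:
  assumes "p dvd M" "p dvd nv (total (run M n (init M d)))"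
  shows "p dvd (\<Sum>k = 0..n. fact (k * d + 1))"
proof -
  obtain D A S where st: "run M n (init M d) = St D A S" by (cases "run M n (init M d)")
  have "[nv S = (\<Sum>k = 0..n. fact (k * d + 1))] (mod M)"
    using represents_state_run[of n d] by (simp add: st represents_def)
  then have "[nv S = (\<Sum>k = 0..n. fact (k * d + 1))] (mod p)"
    using assms(1) by (rule cong_dvd_modulus_nat)
  then show ?thesis using assms(2) by (simp add: st cong_dvd_iff)
qed

lemma finite_primes_sum_fact_run:
  assumes "p dvd M" "p dvd nv (total (run M n (init M d)))" "1 < p" "p \<le> Suc n * d + 1"
  shows "finite (primes_sum_fact d)"
  using assms dvd_sum_fact finite_primes_sum_fact by blast

end

subsection \<open>The prime divisors\<close>

text \<open>
  Several of the prime divisors share one modulus, which only has to be a common multiple of them.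
\<close>

declare enc_numeral [simp]

lemmas table_3451927 = sub_sel_table[of 3451927, simplified] mont_table[of 3451927, simplified]
lemmas table_3547203 = sub_sel_table[of 3547203, simplified] mont_table[of 3547203, simplified]
lemmas table_3245749 = sub_sel_table[of 3245749, simplified] mont_table[of 3245749, simplified]
lemmas table_3275465 = sub_sel_table[of 3275465, simplified] mont_table[of 3275465, simplified]
lemmas table_3325133 = sub_sel_table[of 3325133, simplified] mont_table[of 3325133, simplified]
lemmas table_3977273 = sub_sel_table[of 3977273, simplified] mont_table[of 3977273, simplified]

declare enc_numeral [simp del]

interpretation M3451927: modulus 3451927
  by unfold_locales simp_all

interpretation M3547203: modulus 3547203
  by unfold_locales simp_all

interpretation M3245749: modulus 3245749
  by unfold_locales simp_all

interpretation M3275465: modulus 3275465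
  by unfold_locales simp_all

interpretation M3325133: modulus 3325133
  by unfold_locales simp_all

interpretation M3977273: modulus 3977273
  by unfold_locales simp_all

text \<open>Here 1! + 2! = 3 = 2 * 1 + 1.\<close>

lemma finite_1: "finite (primes_sum_fact 1)"
  by (rule finite_primes_sum_fact[of 3 1 1]) (simp_all add: numeral_3_eq_3)

text \<open>The modulus is 32261 * 107. Here and below, each step count \<open>n\<close> is the
  least one with \<open>p \<le> Suc n * d + 1\<close>; from there on the sums are constant modulo
  \<open>p\<close>.\<close>

lemma finite_3451927:
  "finite (primes_sum_fact 16)"
  "finite (primes_sum_fact 2)"
proof -
  have "32261 dvd nv (total (run 3451927 2016 (init 3451927 16))) \<and>
      107 dvd nv (total (run 3451927 52 (init 3451927 2)))"
    \<comment> \<open>The first call evaluates the interval in \<open>init\<close>, the second runs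
      the computation on digits, the third evaluates the resulting digits and checks
      divisibility.\<close>
    by (simp add: init_def, simp only: comp_rules table_3451927, simp)
  then show "finite (primes_sum_fact 16)"
    "finite (primes_sum_fact 2)"
    using M3451927.finite_primes_sum_fact_run[of 32261 2016 16]
      M3451927.finite_primes_sum_fact_run[of 107 52 2]
    by simp_all
qed

text \<open>The modulus is 3 * 6323 * 11 * 17, where the 3 lifts it into the range required by
  \<open>modulus\<close>.\<close>

lemma finite_3547203:
  "finite (primes_sum_fact 4)"
  "finite (primes_sum_fact 9)"
  "finite (primes_sum_fact 15)"
proof -
  have "6323 dvd nv (total (run 3547203 1580 (init 3547203 4))) \<and>
      11 dvd nv (total (run 3547203 1 (init 3547203 9))) \<and>
      17 dvd nv (total (run 3547203 1 (init 3547203 15)))"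
    by (simp add: init_def, simp only: comp_rules table_3547203, simp)
  then show "finite (primes_sum_fact 4)"
    "finite (primes_sum_fact 9)"
    "finite (primes_sum_fact 15)"
    using M3547203.finite_primes_sum_fact_run[of 6323 1580 4]
      M3547203.finite_primes_sum_fact_run[of 11 1 9]
      M3547203.finite_primes_sum_fact_run[of 17 1 15]
    by simp_all
qed

lemma finite_3245749:
  "finite (primes_sum_fact 10)"
  "finite (primes_sum_fact 6)"
  "finite (primes_sum_fact 22)"
  "finite (primes_sum_fact 11)"
proof -
  have "4093 dvd nv (total (run 3245749 409 (init 3245749 10))) \<and>
      61 dvd nv (total (run 3245749 9 (init 3245749 6))) \<and>
      61 dvd nv (total (run 3245749 2 (init 3245749 22))) \<and>
      13 dvd nv (total (run 3245749 1 (init 3245749 11)))"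
    by (simp add: init_def, simp only: comp_rules table_3245749, simp)
  then show "finite (primes_sum_fact 10)"
    "finite (primes_sum_fact 6)"
    "finite (primes_sum_fact 22)"
    "finite (primes_sum_fact 11)"
    using M3245749.finite_primes_sum_fact_run[of 4093 409 10]
      M3245749.finite_primes_sum_fact_run[of 61 9 6]
      M3245749.finite_primes_sum_fact_run[of 61 2 22]
      M3245749.finite_primes_sum_fact_run[of 13 1 11]
    by simp_all
qed

lemma finite_3275465:
  "finite (primes_sum_fact 14)"
  "finite (primes_sum_fact 12)"
  "finite (primes_sum_fact 3)"
proof -
  have "2549 dvd nv (total (run 3275465 181 (init 3275465 14))) \<and>
      257 dvd nv (total (run 3275465 21 (init 3275465 12))) \<and>
      5 dvd nv (total (run 3275465 1 (init 3275465 3)))"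
    by (simp add: init_def, simp only: comp_rules table_3275465, simp)
  then show "finite (primes_sum_fact 14)"
    "finite (primes_sum_fact 12)"
    "finite (primes_sum_fact 3)"
    using M3275465.finite_primes_sum_fact_run[of 2549 181 14]
      M3275465.finite_primes_sum_fact_run[of 257 21 12]
      M3275465.finite_primes_sum_fact_run[of 5 1 3]
    by simp_all
qed

lemma finite_3325133:
  "finite (primes_sum_fact 24)"
  "finite (primes_sum_fact 5)"
  "finite (primes_sum_fact 7)"
  "finite (primes_sum_fact 17)"
  "finite (primes_sum_fact 13)"
  "finite (primes_sum_fact 21)"
proof -
  have "1087 dvd nv (total (run 3325133 45 (init 3325133 24))) \<and>
      7 dvd nv (total (run 3325133 1 (init 3325133 5))) \<and>
      19 dvd nv (total (run 3325133 2 (init 3325133 7))) \<and>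
      19 dvd nv (total (run 3325133 1 (init 3325133 17))) \<and>
      23 dvd nv (total (run 3325133 1 (init 3325133 13))) \<and>
      23 dvd nv (total (run 3325133 1 (init 3325133 21)))"
    by (simp add: init_def, simp only: comp_rules table_3325133, simp)
  then show "finite (primes_sum_fact 24)"
    "finite (primes_sum_fact 5)"
    "finite (primes_sum_fact 7)"
    "finite (primes_sum_fact 17)"
    "finite (primes_sum_fact 13)"
    "finite (primes_sum_fact 21)"
    using M3325133.finite_primes_sum_fact_run[of 1087 45 24]
      M3325133.finite_primes_sum_fact_run[of 7 1 5]
      M3325133.finite_primes_sum_fact_run[of 19 2 7]
      M3325133.finite_primes_sum_fact_run[of 19 1 17]
      M3325133.finite_primes_sum_fact_run[of 23 1 13]
      M3325133.finite_primes_sum_fact_run[of 23 1 21]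
    by simp_all
qed

text \<open>
  The case $d = 19$ is cut into pieces that can be checked in parallel.
\<close>

definition state1 :: state where
  "state1 = St
    [(XD (XF (XA (X2 (X9 (X1 E)))))), (XB (X7 (X0 (X8 (X9 (X1 E)))))),
    (X1 (X1 (X0 (XB (XE (X3 E)))))), (X2 (X1 (X0 (X6 (X3 (X0 E)))))),
    (XE (X9 (XC (X0 (X2 (X1 E)))))), (X8 (X2 (X4 (X7 (X8 (X3 E)))))),
    (XE (XF (X6 (X5 (XC (X2 E)))))), (X1 (XD (X9 (XE (X9 (X3 E)))))),
    (X3 (XB (X7 (XC (X2 (X2 E)))))), (X5 (X7 (X1 (X9 (X5 (X2 E)))))),
    (X4 (X0 (X8 (XD (XD (X1 E)))))), (XF (X5 (XC (X2 (X6 (X0 E)))))),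
    (X1 (X9 (XE (X2 (X7 (X3 E)))))), (X2 (X1 (X0 (XF (XA (X2 E)))))),
    (X4 (X1 (XA (X4 (XA (X0 E)))))), (XA (X8 (XE (XD (X1 (X2 E)))))),
    (XB (X9 (X6 (X1 (X1 (X3 E)))))), (XC (X7 (X1 (X6 (XC (X0 E)))))),
    (X7 (XF (X8 (XA (X9 (X3 E)))))), (X5 (XE (X2 (XA (X5 (X0 E))))))]
    (X1 (X0 (X7 (X0 (XB (X2 E)))))) (X0 (X0 (X5 (XA (X6 (X0 E))))))"

definition state2 :: state where
  "state2 = St
    [(XB (XA (X3 (XD (X7 (X1 E)))))), (XD (X1 (XA (X3 (X5 (X3 E)))))),
    (XB (XD (X8 (X3 (XC (X0 E)))))), (X0 (X5 (X6 (XF (X4 (X3 E)))))),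
    (XF (X9 (X0 (X5 (XC (X2 E)))))), (XA (X9 (XE (X3 (X9 (X1 E)))))),
    (XB (X7 (XA (XB (XE (X1 E)))))), (XF (X4 (XE (X4 (X9 (X3 E)))))),
    (XF (X0 (XE (X4 (XF (X1 E)))))), (XC (XA (X6 (X5 (XD (X2 E)))))),
    (X5 (X7 (X2 (XC (X5 (X2 E)))))), (XC (X5 (X9 (X8 (X1 (X1 E)))))),
    (X3 (XA (X6 (X7 (XF (X3 E)))))), (XA (XF (X0 (X9 (X4 (X3 E)))))),
    (X8 (X0 (X7 (XC (X4 (X2 E)))))), (XC (XC (X2 (XD (X5 (X0 E)))))),
    (XD (X2 (X5 (X3 (X6 (X0 E)))))), (X2 (XF (XD (X6 (XE (X0 E)))))),
    (XE (XF (X5 (XD (X3 (X0 E)))))), (X5 (XE (X2 (XA (X5 (X0 E))))))]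
    (XC (X7 (XF (XA (X8 (X2 E)))))) (X7 (X3 (X3 (X7 (X5 (X2 E))))))"

definition state3 :: state where
  "state3 = St
    [(XC (X5 (X1 (X5 (X8 (X3 E)))))), (X2 (XB (XC (XF (X1 (X3 E)))))),
    (XB (X5 (X0 (X6 (XB (X3 E)))))), (X6 (X3 (X0 (X0 (XC (X0 E)))))),
    (X4 (X1 (X2 (XD (X4 (X3 E)))))), (X9 (X8 (XB (XB (X1 (X2 E)))))),
    (X5 (X4 (XA (X4 (XB (X3 E)))))), (X4 (X6 (X6 (X7 (XB (X2 E)))))),
    (X7 (X0 (XC (X4 (XE (X3 E)))))), (X3 (X1 (X9 (XA (X7 (X2 E)))))),
    (X0 (XD (X3 (X8 (X7 (X3 E)))))), (XA (XD (X5 (X2 (X6 (X1 E)))))),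
    (X3 (X0 (XE (XF (X7 (X2 E)))))), (XF (X7 (X6 (X0 (XD (X0 E)))))),
    (XB (X2 (X4 (X4 (X6 (X2 E)))))), (X3 (XA (X3 (X4 (XB (X2 E)))))),
    (X4 (X1 (XF (X1 (X8 (X0 E)))))), (X1 (X1 (X3 (XC (X1 (X3 E)))))),
    (XE (X3 (X3 (XB (XA (X0 E)))))), (X5 (XE (X2 (XA (X5 (X0 E))))))]
    (XE (X8 (X2 (XE (X6 (X3 E)))))) (X2 (XA (XC (X4 (XE (X2 E))))))"

definition state4 :: state where
  "state4 = St
    [(XB (X7 (X5 (X8 (X7 (X0 E)))))), (X3 (X4 (X5 (XA (XD (X2 E)))))),
    (X2 (X1 (X7 (X9 (XF (X1 E)))))), (X7 (X2 (XC (XF (X9 (X0 E)))))),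
    (XA (X7 (X4 (XB (X2 (X3 E)))))), (X6 (XD (X4 (X3 (X7 (X3 E)))))),
    (X0 (XB (X4 (XF (XD (X0 E)))))), (X2 (XA (X0 (XB (X6 (X3 E)))))),
    (X8 (X2 (X8 (XB (XF (X2 E)))))), (X6 (XF (X8 (X1 (X5 (X0 E)))))),
    (X7 (X5 (X7 (X8 (XF (X3 E)))))), (X2 (X5 (X0 (XC (X1 (X2 E)))))),
    (XF (X8 (X0 (X2 (XB (X3 E)))))), (X6 (X2 (X6 (XE (X4 (X3 E)))))),
    (X3 (X1 (XF (X2 (X8 (X1 E)))))), (X1 (XC (X4 (X0 (X9 (X1 E)))))),
    (XF (X9 (X2 (XB (X4 (X1 E)))))), (X0 (XA (X0 (XB (X9 (X3 E)))))),
    (XE (X7 (X0 (X9 (X1 (X1 E)))))), (X5 (XE (X2 (XA (X5 (X0 E))))))]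
    (XC (X8 (XC (XF (X4 (X1 E)))))) (X7 (XB (XB (XD (X8 (X0 E))))))"

definition state5 :: state where
  "state5 = St
    [(X4 (X6 (X2 (X1 (XF (X0 E)))))), (X2 (XB (XC (XF (X1 (X3 E)))))),
    (X8 (XC (X0 (X6 (XA (X3 E)))))), (X4 (XE (X3 (XB (X2 (X3 E)))))),
    (X1 (XC (XB (X1 (XD (X1 E)))))), (XB (XC (X8 (X1 (X5 (X3 E)))))),
    (X5 (X1 (X0 (XE (XE (X1 E)))))), (X6 (XD (X1 (XC (XD (X0 E)))))),
    (XA (XE (X5 (XF (X2 (X2 E)))))), (X8 (X3 (X7 (XB (XD (X1 E)))))),
    (XB (X0 (X4 (X5 (X8 (X2 E)))))), (X8 (X3 (X7 (X0 (X1 (X1 E)))))),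
    (XF (X7 (X0 (X5 (X6 (X2 E)))))), (X1 (XE (X8 (X7 (XF (X3 E)))))),
    (X4 (X1 (X2 (X2 (X5 (X1 E)))))), (X9 (XC (X5 (X6 (XE (X0 E)))))),
    (XD (X1 (XE (XC (X9 (X0 E)))))), (XF (X9 (X6 (X3 (X6 (X2 E)))))),
    (XE (XB (XD (X6 (X8 (X1 E)))))), (X5 (XE (X2 (XA (X5 (X0 E))))))]
    (XA (XB (X2 (XD (XE (X0 E)))))) (X6 (XE (XD (XF (X4 (X0 E))))))"

definition state6 :: state where
  "state6 = St
    [(XA (XA (X2 (X5 (XC (X2 E)))))), (XD (X1 (XA (X3 (X5 (X3 E)))))),
    (XF (X8 (XA (X3 (XA (X0 E)))))), (X8 (X4 (XC (X4 (X4 (X3 E)))))),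
    (X8 (XA (X2 (X1 (X6 (X2 E)))))), (X1 (X2 (X3 (X8 (X5 (X1 E)))))),
    (XE (XC (X0 (XD (XE (X1 E)))))), (X2 (X6 (X0 (X8 (X7 (X0 E)))))),
    (X8 (X6 (X2 (X8 (X7 (X3 E)))))), (XD (X0 (X7 (X7 (X1 (X1 E)))))),
    (X3 (XF (X0 (X7 (XC (X1 E)))))), (XA (X8 (X8 (XD (X6 (X2 E)))))),
    (X1 (X9 (X7 (XF (X2 (X2 E)))))), (X7 (X7 (X4 (X9 (XA (X2 E)))))),
    (X0 (X9 (X0 (XC (XA (X0 E)))))), (XB (X6 (X1 (X7 (X0 (X1 E)))))),
    (XF (X4 (X0 (XB (XE (X3 E)))))), (X7 (X4 (X5 (X0 (X4 (X3 E)))))),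
    (XE (XF (XA (X4 (XF (X1 E)))))), (X5 (XE (X2 (XA (X5 (X0 E))))))]
    (X7 (X8 (XD (XB (XB (X1 E)))))) (XB (XF (X6 (X6 (XA (X0 E))))))"

definition state7 :: state where
  "state7 = St
    [(X1 (XC (X4 (X0 (XA (X0 E)))))), (XB (X7 (X0 (X8 (X9 (X1 E)))))),
    (X3 (XB (X3 (XC (XF (X0 E)))))), (X9 (X2 (X6 (XB (XC (X3 E)))))),
    (XA (X2 (XD (X9 (XB (X2 E)))))), (XD (XE (X9 (XF (XB (X0 E)))))),
    (X7 (XF (XC (X9 (X0 (X3 E)))))), (X3 (X9 (XB (X1 (XC (X1 E)))))),
    (X5 (X6 (X4 (X8 (XF (X1 E)))))), (XC (XE (X6 (XC (X8 (X3 E)))))),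
    (X1 (X1 (X5 (XC (X2 (X1 E)))))), (X0 (XD (X9 (XA (XA (X3 E)))))),
    (X7 (X8 (X8 (XC (XF (X3 E)))))), (X5 (XA (X9 (XC (X4 (X2 E)))))),
    (X2 (XF (X3 (XA (X1 (X3 E)))))), (XD (X9 (XD (X9 (X6 (X2 E)))))),
    (X2 (X1 (X7 (XD (X7 (X1 E)))))), (XF (X5 (XC (X6 (X6 (X2 E)))))),
    (XE (X3 (X8 (X2 (X6 (X2 E)))))), (X5 (XE (X2 (XA (X5 (X0 E))))))]
    (X6 (X5 (X6 (X5 (X2 (X3 E)))))) (XD (X2 (X4 (X3 (XB (X1 E))))))"

text \<open>Each piece starts from a literal state, so its evaluation is independent of the others.
  The last list entry agrees in all states, since the 19th difference of a polynomial of degree 19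
  is constant.\<close>

lemma run1: "run 3977273 26166 (init 3977273 19) = state1"
  by (simp add: init_def state1_def, simp only: comp_rules table_3977273)

lemma run2: "run 3977273 26166 state1 = state2"
  unfolding state1_def state2_def by (simp only: comp_rules table_3977273)

lemma run3: "run 3977273 26166 state2 = state3"
  unfolding state2_def state3_def by (simp only: comp_rules table_3977273)

lemma run4: "run 3977273 26166 state3 = state4"
  unfolding state3_def state4_def by (simp only: comp_rules table_3977273)

lemma run5: "run 3977273 26166 state4 = state5"
  unfolding state4_def state5_def by (simp only: comp_rules table_3977273)

lemma run6: "run 3977273 26166 state5 = state6"
  unfolding state5_def state6_def by (simp only: comp_rules table_3977273)

lemma run7: "run 3977273 26166 state6 = state7"
  unfolding state6_def state7_def by (simp only: comp_rules table_3977273)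

lemma run8: "3977273 dvd nv (total (run 3977273 26168 state7))"
  unfolding state7_def by (simp only: comp_rules table_3977273, simp)

lemma run_add: "run M (m + n) s = run M n (run M m s)"
  by (simp add: run_def funpow_add add.commute[of m])

lemma finite_3977273: "finite (primes_sum_fact 19)"
proof -
  \<comment> \<open>The pieces add up to 209330, the least \<open>n\<close> with
    \<open>3977273 \<le> Suc n * 19 + 1\<close>.\<close>
  have "run 3977273 (26166 + 26166 + 26166 + 26166 + 26166 + 26166 + 26166 + 26168)
      (init 3977273 19) = run 3977273 26168 state7"
    by (simp only: run_add run1 run2 run3 run4 run5 run6 run7)
  then have "3977273 dvd nv (total (run 3977273 209330 (init 3977273 19)))"
    using run8 by simp
  then show ?thesis
    by (intro M3977273.finite_primes_sum_fact_run[of 3977273 209330]) simp_all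
qed

theorem theorem1p1:
  fixes S :: "nat set"
  assumes "S = {d. d \<le> 25} - {0, 8, 18, 20, 23, 25}"
  shows "finite {p :: nat. prime p \<and>
           (\<exists>(d, n) \<in> S \<times> (UNIV :: nat set). p = (\<Sum>k = 0..n. fact (k * d + 1)))}"
proof -
  have less_26: "d < 26 \<Longrightarrow> d \<in> {0, 1, 2, 3, 4, 5, 6, 7, 8, 9, 10, 11, 12, 13, 14, 15, 16, 17,
      18, 19, 20, 21, 22, 23, 24, 25}" for d :: nat
    by (simp add: numeral_eq_Suc less_Suc_eq)
  have "d \<in> {1, 2, 3, 4, 5, 6, 7, 9, 10, 11, 12, 13, 14, 15, 16, 17, 19, 21, 22, 24}"
    if "d \<in> S" for d
  proof -
    have "d < 26" "d \<notin> {0, 8, 18, 20, 23, 25}" using that assms by auto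
    with less_26[of d] show ?thesis by blast
  qed
  then have "finite (primes_sum_fact d)" if "d \<in> S" for d
    using that finite_1 finite_3451927 finite_3547203 finite_3245749 finite_3275465 finite_3325133
      finite_3977273
    by fastforce
  moreover have "finite S" using assms by simp
  ultimately have "finite (\<Union>d\<in>S. primes_sum_fact d)" by blast
  then show ?thesis
    by (rule rev_finite_subset) (auto simp: primes_sum_fact_def)
qed

end
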